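(* Let $A = \begin{pmatrix} a_{1,1} & a_{1,2} \\ a_{2,1} & a_{2,2} \end{pmatrix}$ and $B = \begin{pmatrix} b_{1,1} & b_{1,2} \\ b_{2,1} & b_{2,2} \end{pmatrix}$ be matrices in $GL_2(\mathbf{R}_{\geq 0})$. If $$a_{1,1} \leq a_{2,1} \quad\text{and}\quad a_{1,2} \leq a_{2,2}$$ and if $$b_{1,1} \geq b_{2,1} \quad\text{and}\quad b_{1,2} \geq b_{2,2},$$ then the submonoid of $GL_2(\mathbf{R}_{\geq 0})$ generated by $A$ and $B$ is free, and $\{A,B\}$ is a free set of generators for this monoid.
   Context: A monoid is a semigroup with an identity. $\mathbf{R}_{\geq 0}$ denotes the set of nonnegative real numbers. $GL_2(\mathbf{R}_{\geq 0})$ denotes the multiplicative monoid of $2\times 2$ matrices with nonzero determinant and with all entries in $\mathbf{R}_{\geq 0}$ (the inverse of such a matrix is not required to have nonnegative entries). For $A, B \in GL_2(\mathbf{R}_{\geq 0})$, the monoid $M(A,B)$ generated by $A$ and $B$ consists of all matrices that can be represented as products of nonnegative powers of $A$ and $B$ (the identity matrix being the empty product). The matrices $A$ and $B$ freely generate this monoid (that is, $\{A,B\}$ is a free set of generators for it) if every matrix in $M(A,B)$ has a unique representation as a product of powers of $A$ and $B$; equivalently, distinct finite sequences (words, including the empty one) in the two letters $A, B$ have distinct products. *)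

theory Defs
  imports "HOL-Algebra.Group" "HOL-Analysis.Analysis"
begin

text \<open>The inverse of a member need not have nonnegative entries, so this is only a monoid.\<close>

definition GL2_nonneg :: "(real^2^2) monoid" where
  "GL2_nonneg =
    \<lparr>carrier = {A. det A \<noteq> 0 \<and> (\<forall>i j. 0 \<le> A $ i $ j)},
     monoid.mult = (**),
     one = mat 1\<rparr>"

definition word_prod :: "('a, 'b) monoid_scheme \<Rightarrow> 'a list \<Rightarrow> 'a" where
  "word_prod G w = foldr (\<otimes>\<^bsub>G\<^esub>) w \<one>\<^bsub>G\<^esub>"

definition gen_submonoid :: "('a, 'b) monoid_scheme \<Rightarrow> 'a set \<Rightarrow> 'a set" where
  "gen_submonoid G S = word_prod G ` lists S"

definition free_generators :: "('a, 'b) monoid_scheme \<Rightarrow> 'a set \<Rightarrow> bool" where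
  "free_generators G S \<longleftrightarrow>
    S \<subseteq> carrier G \<and> (\<forall>x\<in>carrier G. \<exists>!w. w \<in> lists S \<and> word_prod G w = x)"

definition free_monoid :: "('a, 'b) monoid_scheme \<Rightarrow> bool" where
  "free_monoid G \<longleftrightarrow> monoid G \<and> (\<exists>S. free_generators G S)"

lemma monoid_GL2_nonneg: "monoid GL2_nonneg"
proof (rule monoidI)
  fix x y :: "real^2^2"
  assume "x \<in> carrier GL2_nonneg" "y \<in> carrier GL2_nonneg"
  then show "x \<otimes>\<^bsub>GL2_nonneg\<^esub> y \<in> carrier GL2_nonneg"
    by (simp add: GL2_nonneg_def det_mul) (simp add: matrix_matrix_mult_def sum_nonneg)
next
  show "\<one>\<^bsub>GL2_nonneg\<^esub> \<in> carrier GL2_nonneg"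
    by (simp add: GL2_nonneg_def det_I) (simp add: mat_def)
qed (auto simp: GL2_nonneg_def matrix_mul_assoc)

lemma (in monoid) word_prod_closed:
  "set w \<subseteq> carrier G \<Longrightarrow> word_prod G w \<in> carrier G"
  by (induction w) (auto simp: word_prod_def)

lemma (in monoid) word_prod_append:
  assumes "set u \<subseteq> carrier G" "set v \<subseteq> carrier G"
  shows "word_prod G (u @ v) = word_prod G u \<otimes> word_prod G v"
  using assms word_prod_closed[unfolded word_prod_def]
  by (induction u) (auto simp: word_prod_def m_assoc)

text \<open>\<^term>\<open>gen_submonoid G S\<close> is the least submonoid of \<open>G\<close> containing \<open>S\<close>.\<close>

lemma (in monoid) submonoid_gen_submonoid:
  assumes S: "S \<subseteq> carrier G"
  shows "submonoid (gen_submonoid G S) G"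
proof
  show "gen_submonoid G S \<subseteq> carrier G"
    using word_prod_closed S by (fastforce simp: gen_submonoid_def)
  show "x \<otimes> y \<in> gen_submonoid G S"
    if xy: "x \<in> gen_submonoid G S" "y \<in> gen_submonoid G S" for x y
  proof -
    obtain u v where uv: "x = word_prod G u" "y = word_prod G v" "u \<in> lists S" "v \<in> lists S"
      using xy by (auto simp: gen_submonoid_def)
    then have "x \<otimes> y = word_prod G (u @ v)"
      using word_prod_append[of u v] S by (simp add: lists_eq_set subset_iff)
    with uv show ?thesis by (auto simp: gen_submonoid_def)
  qed
  show "\<one> \<in> gen_submonoid G S"
    unfolding gen_submonoid_def by (rule image_eqI[of _ _ "[]"]) (auto simp: word_prod_def)
qed

lemma (in monoid) gen_submonoid_incl:
  assumes S: "S \<subseteq> carrier G"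
  shows "S \<subseteq> gen_submonoid G S"
proof
  fix x assume "x \<in> S"
  with S show "x \<in> gen_submonoid G S"
    unfolding gen_submonoid_def by (intro image_eqI[of _ _ "[x]"]) (auto simp: word_prod_def)
qed

lemma gen_submonoid_least:
  assumes "submonoid H G" "S \<subseteq> H"
  shows "gen_submonoid G S \<subseteq> H"
proof -
  have "word_prod G w \<in> H" if "w \<in> lists S" for w
    using that assms
    by (induction w) (auto simp: word_prod_def submonoid.m_closed submonoid.one_closed)
  then show ?thesis by (auto simp: gen_submonoid_def)
qed

end

theory Submission
  imports Defs
begin

text \<open>
  The first letter of a word can be read off from its product. Left multiplication by a nonnegative
  matrix whose first row is dominated by its second row produces, from any nonnegative matrix,
  another matrix of this kind, because the rows of a product are the combinations of the rows of the
  right factor with the entries of the left factor as coefficients. Hence a nonempty word starting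
  with \<open>A\<close> has a product whose second row dominates the first, and a word starting with
  \<open>B\<close> one whose first row dominates the second. A matrix with both properties has two equal
  rows and is singular, so the two cases exclude each other; and the identity matrix, the product of
  the empty word, has neither property. As the generators can be cancelled on the left,
  peeling off first letters shows that words with the same product are equal
  (\<open>inj_on_word_prod\<close>).
\<close>

text \<open>
  A ping-pong criterion: the images of left translation by the generators are pairwise disjoint and
  avoid the unit, so the product determines whether a word is empty and, if not, its first letter;
  cancelling that letter leaves a shorter word.
\<close>

lemma (in monoid) inj_on_word_prod:
  assumes S: "S \<subseteq> carrier G"
    and cancel: "\<And>s x y. \<lbrakk>s \<in> S; x \<in> carrier G; y \<in> carrier G; s \<otimes> x = s \<otimes> y\<rbrakk> \<Longrightarrow> x = y"
    and disjoint: "\<And>s t x y. \<lbrakk>s \<in> S; t \<in> S; x \<in> carrier G; y \<in> carrier G; s \<otimes> x = t \<otimes> y\<rbrakk> \<Longrightarrow> s = t"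
    and proper: "\<And>s x. \<lbrakk>s \<in> S; x \<in> carrier G\<rbrakk> \<Longrightarrow> s \<otimes> x \<noteq> \<one>"
  shows "inj_on (word_prod G) (lists S)"
proof (rule inj_onI)
  have closed: "word_prod G w \<in> carrier G" if "w \<in> lists S" for w
    using word_prod_closed that S by (auto simp: lists_eq_set)
  have empty: "word_prod G [] = \<one>" and step: "\<And>s w. word_prod G (s # w) = s \<otimes> word_prod G w"
    by (simp_all add: word_prod_def)
  fix u v
  assume "u \<in> lists S" "v \<in> lists S" "word_prod G u = word_prod G v"
  then show "u = v"
  proof (induction u arbitrary: v rule: list.induct)
    case Nil
    then show ?case
      using proper closed by (cases v) (fastforce simp: empty step)+
  next
    case u: (Cons s u')
    show ?case
    proof (cases v)
      case v: Nil
      then show ?thesis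
        using u.prems proper[of s "word_prod G u'"] closed by (auto simp: empty step)
    next
      case v: (Cons t v')
      have in_S: "s \<in> S" "t \<in> S" "u' \<in> lists S" "v' \<in> lists S"
        using u.prems v by auto
      have eq: "s \<otimes> word_prod G u' = t \<otimes> word_prod G v'"
        using u.prems v by (simp add: step)
      have "s = t"
        using disjoint eq in_S closed by blast
      moreover have "u' = v'"
        using u.IH cancel eq in_S closed \<open>s = t\<close> by blast
      ultimately show ?thesis
        using v by simp
    qed
  qed
qed

lemma (in monoid) free_generators_gen_submonoid:
  assumes S: "S \<subseteq> carrier G"
    and inj: "inj_on (word_prod G) (lists S)"
  shows "free_generators (G\<lparr>carrier := gen_submonoid G S\<rparr>) S"
proof -
  have "word_prod (G\<lparr>carrier := gen_submonoid G S\<rparr>) = word_prod G"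
    by (simp add: word_prod_def fun_eq_iff)
  moreover have "\<exists>!w. w \<in> lists S \<and> word_prod G w = x" if "x \<in> gen_submonoid G S" for x
    using that inj unfolding gen_submonoid_def inj_on_def by blast
  ultimately show ?thesis
    using gen_submonoid_incl[OF S] by (simp add: free_generators_def)
qed

definition row_le :: "2 \<Rightarrow> 2 \<Rightarrow> real^2^2 \<Rightarrow> bool" where
  "row_le i k M \<longleftrightarrow> (\<forall>j. M $ i $ j \<le> M $ k $ j)"

text \<open>
  Each row of \<open>M ** X\<close> is the combination of the rows of \<open>X\<close> weighted by the
  corresponding row of \<open>M\<close>; larger weights on nonnegative rows give a larger sum.
\<close>

lemma row_le_mult:
  assumes "row_le i k M" and "\<And>i j. 0 \<le> X $ i $ j"
  shows "row_le i k (M ** X)"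
  using assms by (auto simp: row_le_def matrix_matrix_mult_def intro!: sum_mono mult_right_mono)

lemma det_eq_0_if_row_le_both:
  assumes "row_le 1 2 M" "row_le 2 1 M"
  shows "det M = 0"
proof -
  have "M $ 1 $ j = M $ 2 $ j" for j
    using assms by (simp add: row_le_def order_antisym)
  then show ?thesis
    by (simp add: det_2)
qed

lemma not_row_le_mat_1:
  assumes "i \<noteq> k"
  shows "\<not> row_le i k (mat 1)"
  using assms by (auto simp: row_le_def mat_def intro!: exI[of _ i])

lemma GL2_nonneg_left_cancel:
  assumes "M \<in> carrier GL2_nonneg" "M ** X = M ** Y"
  shows "X = Y"
proof -
  obtain N where "N ** M = mat 1"
    using assms(1) invertible_det_nz[of M] by (auto simp: GL2_nonneg_def invertible_def)
  then show ?thesis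
    using assms(2) by (metis matrix_mul_assoc matrix_mul_lid)
qed

theorem theorem1:
  fixes A B :: "real^2^2"
  assumes "A \<in> carrier GL2_nonneg"
    and "B \<in> carrier GL2_nonneg"
    and "A $ 1 $ 1 \<le> A $ 2 $ 1" and "A $ 1 $ 2 \<le> A $ 2 $ 2"
    and "B $ 1 $ 1 \<ge> B $ 2 $ 1" and "B $ 1 $ 2 \<ge> B $ 2 $ 2"
  shows "free_monoid (GL2_nonneg\<lparr>carrier := gen_submonoid GL2_nonneg {A, B}\<rparr>)
    \<and> free_generators (GL2_nonneg\<lparr>carrier := gen_submonoid GL2_nonneg {A, B}\<rparr>) {A, B}
    \<and> A \<noteq> B"
proof -
  interpret monoid GL2_nonneg
    by (rule monoid_GL2_nonneg)
  note mult = GL2_nonneg_def[THEN arg_cong[of _ _ monoid.mult], simplified]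
    and one = GL2_nonneg_def[THEN arg_cong[of _ _ monoid.one], simplified]
  have AB: "{A, B} \<subseteq> carrier GL2_nonneg"
    using assms by simp
  have A: "row_le 1 2 A" and B: "row_le 2 1 B"
    using assms by (simp_all add: row_le_def forall_2)
  have AX: "row_le 1 2 (A ** X)" and BX: "row_le 2 1 (B ** X)" if "X \<in> carrier GL2_nonneg" for X
    using that A B by (auto simp: GL2_nonneg_def intro!: row_le_mult)
  have "A \<noteq> B"
    using det_eq_0_if_row_le_both A B assms(1) by (auto simp: GL2_nonneg_def)
  have disjoint: "A ** X \<noteq> B ** Y"
    if X: "X \<in> carrier GL2_nonneg" and Y: "Y \<in> carrier GL2_nonneg" for X Y
  proof
    assume "A ** X = B ** Y"
    then have "det (A ** X) = 0"
      using AX[OF X] BX[OF Y] by (simp add: det_eq_0_if_row_le_both)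
    then show False
      using X assms(1) by (simp add: GL2_nonneg_def det_mul)
  qed
  have "inj_on (word_prod GL2_nonneg) (lists {A, B})"
  proof (rule inj_on_word_prod[OF AB], unfold mult one)
    show "X = Y" if "s \<in> {A, B}" "s ** X = s ** Y" for s X Y
      using that AB GL2_nonneg_left_cancel by blast
    show "s = t"
      if "s \<in> {A, B}" "t \<in> {A, B}" "X \<in> carrier GL2_nonneg" "Y \<in> carrier GL2_nonneg"
        and "s ** X = t ** Y" for s t X Y
      using that disjoint[of X Y] disjoint[of Y X] by auto
    show "s ** X \<noteq> mat 1" if "s \<in> {A, B}" "X \<in> carrier GL2_nonneg" for s X
      using that AX[of X] BX[of X] not_row_le_mat_1[of 1 2] not_row_le_mat_1[of 2 1] by auto
  qed
  then have free: "free_generators (GL2_nonneg\<lparr>carrier := gen_submonoid GL2_nonneg {A, B}\<rparr>) {A, B}"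
    by (rule free_generators_gen_submonoid[OF AB])
  moreover have "monoid (GL2_nonneg\<lparr>carrier := gen_submonoid GL2_nonneg {A, B}\<rparr>)"
    using submonoid.submonoid_is_monoid[OF submonoid_gen_submonoid[OF AB]] monoid_GL2_nonneg by simp
  ultimately show ?thesis
    using \<open>A \<noteq> B\<close> by (auto simp: free_monoid_def)
qed

end
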